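(* Let $G=K_{p_1,\ldots,p_t}$ be a complete $t$-partite graph with $t\ge 3$, of order $n=\sum_i p_i>t$, and let $d_i=n-p_i$. Let $\phi$ be a symmetric real-valued function with $\phi(d_i,d_j)>0$ for all $i\ne j$. Let $S=(s_{ij})_{t\times t}$ be the real symmetric matrix with $s_{ii}=0$ and $s_{ij}=\sqrt{p_ip_j}\,\phi(d_i,d_j)$ for $i\ne j$, and assume that $S$ is nonsingular. Then $\dot A(G)$ has exactly three distinct eigenvalues if and only if there exists a constant $c>0$ such that $$\sqrt{p_ip_j}\,\phi(d_i,d_j)=c\quad\text{for every } i\ne j.$$ In this case, $$\operatorname{Spec}(\dot A(G))=\left\{0^{[n-t]},\,((t-1)c)^{[1]},\,(-c)^{[t-1]}\right\}.$$ Every regular complete multipartite graph (i.e. with $p_1=\cdots=p_t$) satisfies this condition, although the converse need not hold for a general degree-based weight (there are degree-based weights $\phi$ and non-regular complete multipartite graphs satisfying the condition).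
   Context: Graphs are finite, simple and undirected. For a symmetric function $\phi:\mathbb R_{>0}\times\mathbb R_{>0}\to\mathbb R$ and a graph $G$ with vertices $v_1,\dots,v_n$ of degrees $d(v_1),\dots,d(v_n)$, the degree-based weighted adjacency matrix $\dot A(G)$ is the $n\times n$ real symmetric matrix whose $(i,j)$ entry is $\phi(d(v_i),d(v_j))$ if $v_i$ and $v_j$ are adjacent, and $0$ otherwise. $\operatorname{Spec}(M)$ is the multiset of eigenvalues of $M$; $\lambda^{[k]}$ means $\lambda$ repeated with multiplicity $k$. The complete multipartite graph $K_{p_1,\ldots,p_t}$ ($p_i\ge1$) has vertex set partitioned into independent sets of sizes $p_1,\ldots,p_t$, with any two vertices of different parts adjacent; a vertex in the $i$-th part has degree $n-p_i$. *)

theory Defs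
  imports
    "Graph_Theory.Digraph"
    "Jordan_Normal_Form.Spectral_Radius"
begin

text \<open>Finite simple undirected graphs are the locale \<open>graph\<close> of Graph_Theory: finite loop-free
  digraphs without parallel arcs whose arc relation is symmetric. An undirected edge is a pair of
  opposite arcs, so the degree of a vertex is its \<open>out_degree\<close>.\<close>

definition regular_graph :: "('a, 'b) pre_digraph \<Rightarrow> bool" where
  "regular_graph G \<longleftrightarrow> (\<exists>k. \<forall>v \<in> verts G. out_degree G v = k)"

text \<open>\<open>G\<close> is (a labelled copy of) \<open>K\<^bsub>p 0, \<dots>, p (t - 1)\<^esub>\<close>; the \<open>i\<close>-th part is \<open>W i\<close>,
  and only the indices \<open>i < t\<close> matter.\<close>

definition complete_multipartite ::
    "('a, 'b) pre_digraph \<Rightarrow> nat \<Rightarrow> (nat \<Rightarrow> nat) \<Rightarrow> bool" where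
  "complete_multipartite G t p \<longleftrightarrow>
     graph G \<and> (\<forall>i<t. 1 \<le> p i) \<and>
     (\<exists>W. (\<Union>i<t. W i) = verts G \<and> disjoint_family_on W {..<t} \<and>
          (\<forall>i<t. card (W i) = p i) \<and>
          (\<forall>i<t. \<forall>j<t. \<forall>u \<in> W i. \<forall>v \<in> W j. u \<rightarrow>\<^bsub>G\<^esub> v \<longleftrightarrow> i \<noteq> j))"

text \<open>A weight is a function on pairs of positive reals; its values elsewhere are irrelevant, and
  symmetry is required only on that domain.\<close>

definition symmetric_weight :: "(real \<Rightarrow> real \<Rightarrow> real) \<Rightarrow> bool" where
  "symmetric_weight \<phi> \<longleftrightarrow> (\<forall>x>0. \<forall>y>0. \<phi> x y = \<phi> y x)"

text \<open>The vertices are enumerated by the list \<open>vs\<close>.\<close>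

definition weighted_adjacency ::
    "(real \<Rightarrow> real \<Rightarrow> real) \<Rightarrow> ('a, 'b) pre_digraph \<Rightarrow> 'a list \<Rightarrow> real mat" where
  "weighted_adjacency \<phi> G vs =
     mat (length vs) (length vs) (\<lambda>(i, j).
       if vs ! i \<rightarrow>\<^bsub>G\<^esub> vs ! j
       then \<phi> (real (out_degree G (vs ! i))) (real (out_degree G (vs ! j)))
       else 0)"

text \<open>The multiset of eigenvalues: roots of the characteristic polynomial with multiplicity.
  Used for symmetric matrices only, where all complex roots are real.\<close>

definition Spec :: "real mat \<Rightarrow> real multiset" where
  "Spec A = proots (char_poly A)"

definition order_of_parts :: "nat \<Rightarrow> (nat \<Rightarrow> nat) \<Rightarrow> nat" where
  "order_of_parts t p = (\<Sum>i<t. p i)"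

definition part_degree :: "nat \<Rightarrow> (nat \<Rightarrow> nat) \<Rightarrow> nat \<Rightarrow> real" where
  "part_degree t p i = real (order_of_parts t p) - real (p i)"

definition positive_between_parts ::
    "(real \<Rightarrow> real \<Rightarrow> real) \<Rightarrow> nat \<Rightarrow> (nat \<Rightarrow> nat) \<Rightarrow> bool" where
  "positive_between_parts \<phi> t p \<longleftrightarrow>
     (\<forall>i<t. \<forall>j<t. i \<noteq> j \<longrightarrow> \<phi> (part_degree t p i) (part_degree t p j) > 0)"

definition part_matrix ::
    "(real \<Rightarrow> real \<Rightarrow> real) \<Rightarrow> nat \<Rightarrow> (nat \<Rightarrow> nat) \<Rightarrow> real mat" where
  "part_matrix \<phi> t p =
     mat t t (\<lambda>(i, j).
       if i = j then 0
       else sqrt (real (p i) * real (p j)) * \<phi> (part_degree t p i) (part_degree t p j))"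

definition constant_between_parts ::
    "(real \<Rightarrow> real \<Rightarrow> real) \<Rightarrow> nat \<Rightarrow> (nat \<Rightarrow> nat) \<Rightarrow> real \<Rightarrow> bool" where
  "constant_between_parts \<phi> t p c \<longleftrightarrow>
     (\<forall>i<t. \<forall>j<t. i \<noteq> j \<longrightarrow>
        sqrt (real (p i) * real (p j)) * \<phi> (part_degree t p i) (part_degree t p j) = c)"

end

theory Submission
  imports Defs
begin

text \<open>
  Let \<open>S\<close> be the part matrix and let \<open>N\<close> have the normalized indicator vectors of the parts as
  columns. Then \<open>N\<^sup>T * N\<close> is the identity and the weighted adjacency matrix is \<open>N * S * N\<^sup>T\<close>, so its
  characteristic polynomial is \<open>x ^ (n - t)\<close> times that of \<open>S\<close> (\<open>char_poly_weighted_adjacency\<close>).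
  Everything is thereby reduced to the spectrum of \<open>S\<close>: for \<open>n > t\<close> and nonsingular \<open>S\<close>, three
  distinct eigenvalues of the adjacency matrix mean exactly two of \<open>S\<close>.

  If all off-diagonal entries of \<open>S\<close> equal \<open>c\<close>, then \<open>S = c J - c I\<close> with \<open>J\<close> the all-ones matrix of
  rank one, and the characteristic polynomial is explicit (\<open>char_poly_constant_off_diagonal\<close>).

  Conversely, suppose \<open>S\<close> has exactly two eigenvalues \<open>b < a\<close>. Being real symmetric, it satisfies
  \<open>(S - a)(S - b) = 0\<close> (\<open>real_symmetric_two_eigenvalues\<close>), so \<open>T = (S - b) / (a - b)\<close> is idempotent.
  The diagonal of \<open>S\<close> is zero and its other entries are positive, which forces \<open>b < 0\<close> and makes all
  entries of \<open>T\<close> positive. By a Perron--Frobenius argument a positive idempotent matrix has rank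
  one (\<open>positive_idempotent_minors_vanish\<close>). As \<open>T\<close> is symmetric with constant diagonal, all its
  entries are then equal, so the off-diagonal entries of \<open>S\<close> are all \<open>- b\<close>.

  A complete multipartite graph is regular exactly when its parts have equal sizes, and then the
  entries of \<open>S\<close> agree trivially. For the failure of the converse take \<open>K\<^bsub>1,1,2\<^esub>\<close> with a weight that
  divides out the part sizes.
\<close>

section \<open>Determinants of products of rectangular matrices\<close>

text \<open>Both sides are \<open>y ^ m\<close> times the determinant of the block matrix
  \<open>((y I, X), (Y, I))\<close>: multiplying it by a lower block triangular matrix from the right clears
  \<open>Y\<close> and leaves \<open>y I - X Y\<close>, multiplying from the left leaves \<open>y I - Y X\<close>. The
  identity is used for matrices of constant polynomials, with \<open>y\<close> a monic linear polynomial.\<close>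

lemma weinstein_aronszajn:
  fixes X Y :: "'a :: idom mat"
  assumes X: "X \<in> carrier_mat n m" and Y: "Y \<in> carrier_mat m n"
  shows "y ^ m * det (y \<cdot>\<^sub>m 1\<^sub>m n - X * Y) = y ^ n * det (y \<cdot>\<^sub>m 1\<^sub>m m - Y * X)"
proof -
  define M where "M = four_block_mat (y \<cdot>\<^sub>m 1\<^sub>m n) X Y (1\<^sub>m m)"
  define L where "L a = four_block_mat (1\<^sub>m n) (0\<^sub>m n m) (- Y) (a \<cdot>\<^sub>m 1\<^sub>m m)" for a :: 'a
  have M: "M \<in> carrier_mat (n + m) (n + m)" unfolding M_def by simp
  have L: "L a \<in> carrier_mat (n + m) (n + m)" for a unfolding L_def by simp
  have det_L: "det (L a) = a ^ m" for a
    unfolding L_def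
    by (subst det_four_block_mat_upper_right_zero[of _ n _ m]) (use Y in auto)
  have XY: "y \<cdot>\<^sub>m 1\<^sub>m n - X * Y \<in> carrier_mat n n"
    using X Y by (simp add: minus_carrier_mat)
  have "M * L 1 = four_block_mat (y \<cdot>\<^sub>m 1\<^sub>m n - X * Y) X (0\<^sub>m m n) (1\<^sub>m m)"
    unfolding M_def L_def
    by (subst mult_four_block_mat[of _ n n _ m _ m _ _ n _ m]; use X Y in
        \<open>auto intro!: arg_cong2[where f = "\<lambda>a b. four_block_mat a X b (1\<^sub>m m)"] eq_matI\<close>)
  then have "det (M * L 1) = det (y \<cdot>\<^sub>m 1\<^sub>m n - X * Y) * det (1\<^sub>m m)"
    by (simp add: det_four_block_mat_lower_left_zero[OF XY X refl one_carrier_mat])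
  then have right: "det M = det (y \<cdot>\<^sub>m 1\<^sub>m n - X * Y)"
    by (simp add: det_mult[OF M L] det_L)
  have YX: "Y * X \<in> carrier_mat m m"
    using X Y by simp
  have yX: "- Y * (y \<cdot>\<^sub>m 1\<^sub>m n) + y \<cdot>\<^sub>m 1\<^sub>m m * Y = 0\<^sub>m m n"
    using Y by (auto simp: mult_smult_distrib[of _ m n _ n] mult_smult_assoc_mat[of _ m m _ n] intro!: eq_matI)
  have "L y * M = four_block_mat (y \<cdot>\<^sub>m 1\<^sub>m n) X (0\<^sub>m m n) (y \<cdot>\<^sub>m 1\<^sub>m m - Y * X)"
    unfolding M_def L_def using yX
    by (subst mult_four_block_mat[of _ n n _ m _ m _ _ n _ m]; use X Y YX in
        \<open>auto intro!: arg_cong2[where f = "\<lambda>a b. four_block_mat (y \<cdot>\<^sub>m 1\<^sub>m n) X a b"] eq_matI\<close>)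
  then have "det (L y * M) = y ^ n * det (y \<cdot>\<^sub>m 1\<^sub>m m - Y * X)"
    by (simp add: det_four_block_mat_lower_left_zero[of _ n _ m] X Y YX minus_carrier_mat)
  then show ?thesis
    by (simp add: det_mult[OF L M] det_L right)
qed

lemma char_poly_as_det:
  assumes A: "A \<in> carrier_mat n n"
  shows "char_poly A = det ([:0, 1:] \<cdot>\<^sub>m 1\<^sub>m n - map_mat (\<lambda>a. [:a:]) A)"
  unfolding char_poly_defs using A by (intro arg_cong[where f = det] eq_matI) auto

lemma char_poly_mult_commute:
  fixes X Y :: "'a :: idom mat"
  assumes X: "X \<in> carrier_mat n m" and Y: "Y \<in> carrier_mat m n"
  shows "[:0, 1:] ^ m * char_poly (X * Y) = [:0, 1:] ^ n * char_poly (Y * X)"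
  using weinstein_aronszajn[of "map_mat (\<lambda>a. [:a:]) X" n m "map_mat (\<lambda>a. [:a:]) Y" "[:0, 1:]"] X Y
  by (simp add: char_poly_as_det[of _ n] char_poly_as_det[of _ m] map_poly_mult(1)[OF X Y]
      map_poly_mult(1)[OF Y X])

text \<open>With \<open>J\<close> the all-ones matrix and \<open>c J = u v\<close> a column times a row, \<open>x I - (c J - c I) = (x + c) I - c J\<close>, so
  the rectangular determinant identity at \<open>y = x + c\<close> reduces the determinant to a one by one
  determinant.\<close>

lemma char_poly_constant_off_diagonal:
  fixes c :: "'a :: idom"
  assumes "t \<ge> 1"
  shows "char_poly (mat t t (\<lambda>(i, j). if i = j then 0 else c))
       = [:c, 1:] ^ (t - 1) * [:- (of_nat t - 1) * c, 1:]"
proof -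
  define u v :: "'a poly mat"
    where "u = mat t 1 (\<lambda>_. [:c:])" and "v = mat 1 t (\<lambda>_. 1)"
  have u: "u \<in> carrier_mat t 1" and v: "v \<in> carrier_mat 1 t"
    by (auto simp: u_def v_def)
  let ?S = "mat t t (\<lambda>(i, j). if i = j then 0 else c)"
  have "char_poly ?S = det ([:c, 1:] \<cdot>\<^sub>m 1\<^sub>m t - u * v)"
    by (subst char_poly_as_det[of _ t])
      (auto intro!: arg_cong[where f = det] eq_matI simp: u_def v_def scalar_prod_def)
  moreover have "det ([:c, 1:] \<cdot>\<^sub>m 1\<^sub>m 1 - v * u) = [:- (of_nat t - 1) * c, 1:]"
    by (subst det_single)
      (auto simp: u_def v_def scalar_prod_def of_nat_poly algebra_simps minus_carrier_mat)
  ultimately have "[:c, 1:] * char_poly ?S = [:c, 1:] ^ t * [:- (of_nat t - 1) * c, 1:]"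
    using weinstein_aronszajn[OF u v, of "[:c, 1:]"] by simp
  also have "[:c, 1:] ^ t = [:c, 1:] * [:c, 1:] ^ (t - 1)"
    using assms by (cases t) auto
  finally show ?thesis
    by (simp only: mult.assoc mult_left_cancel[of "[:c, 1:]"] pCons_eq_0_iff one_neq_zero simp_thms)
qed

section \<open>Real symmetric matrices with two eigenvalues\<close>

text \<open>Compare \<open>(A v) \<bullet>c v = z (v \<bullet>c v)\<close> with \<open>v \<bullet>c (A v) = cnj z (v \<bullet>c v)\<close>; symmetry makes the
  left-hand sides equal.\<close>

lemma complex_eigenvalue_of_real_symmetric:
  fixes A :: "real mat"
  assumes A: "A \<in> carrier_mat n n" and sym: "transpose_mat A = A"
    and ev: "eigenvalue (map_mat complex_of_real A) z"
  shows "cnj z = z"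
proof -
  let ?A = "map_mat complex_of_real A"
  have cA: "?A \<in> carrier_mat n n" using A by simp
  obtain v where v: "v \<in> carrier_vec n" "v \<noteq> 0\<^sub>v n" "?A *\<^sub>v v = z \<cdot>\<^sub>v v"
    using ev A unfolding eigenvalue_def eigenvector_def by auto
  have symc: "transpose_mat ?A = ?A"
    using sym by (metis map_mat_transpose)
  have conj: "?A *\<^sub>v conjugate v = conjugate (?A *\<^sub>v v)"
    using A v(1) by (intro eq_vecI) (auto simp: scalar_prod_def sum_conjugate)
  have "z * (v \<bullet>c v) = (?A *\<^sub>v v) \<bullet>c v"
    using v by simp
  also have "\<dots> = v \<bullet> (?A *\<^sub>v conjugate v)"
    using transpose_vec_mult_scalar[OF cA, of "conjugate v" v] v(1) symc by simp
  also have "\<dots> = cnj z * (v \<bullet>c v)"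
    using v by (simp add: conj conjugate_smult_vec)
  finally show ?thesis
    using v(1,2) by simp
qed

lemma real_symmetric_char_poly_splits:
  fixes A :: "real mat"
  assumes A: "A \<in> carrier_mat n n" and sym: "transpose_mat A = A"
  shows "\<exists>es. char_poly A = (\<Prod>a\<leftarrow>es. [:- a, 1:])"
proof -
  interpret cpoly: map_poly_inj_idom_hom complex_of_real ..
  let ?A = "map_mat complex_of_real A"
  have cA: "?A \<in> carrier_mat n n" using A by simp
  obtain zs where zs: "char_poly ?A = (\<Prod>z\<leftarrow>zs. [:- z, 1:])"
    using char_poly_factorized[OF cA] by auto
  have "z = of_real (Re z)" if "z \<in> set zs" for z
  proof -
    have "poly (char_poly ?A) z = 0"
      unfolding zs using that by (induction zs) auto
    then show ?thesis
      using complex_eigenvalue_of_real_symmetric[OF A sym] eigenvalue_root_char_poly[OF cA]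
      by (metis Reals_cnj_iff complex_is_Real_iff of_real_Re)
  qed
  then have "(\<Prod>z\<leftarrow>zs. [:- z, 1:]) = (\<Prod>a\<leftarrow>map Re zs. map_poly complex_of_real [:- a, 1:])"
    by (auto intro!: arg_cong[where f = prod_list])
  then have "map_poly complex_of_real (char_poly A)
      = map_poly complex_of_real (\<Prod>a\<leftarrow>map Re zs. [:- a, 1:])"
    using zs of_real_hom.char_poly_hom[OF A, where 'a = complex]
    by (simp add: cpoly.hom_prod_list o_def)
  then have "char_poly A = (\<Prod>a\<leftarrow>map Re zs. [:- a, 1:])"
    by (rule cpoly.eq_iff[THEN iffD1])
  then show ?thesis
    by blast
qed


text \<open>\<open>M * M\<close> is similar to \<open>C * C\<close>, whose diagonal vanishes, and similar matrices have equal
  trace.\<close>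

lemma trace_square_similar_strictly_upper:
  fixes M :: "'a :: comm_ring_1 mat"
  assumes sim: "similar_mat_wit M C P Q" and M: "M \<in> carrier_mat n n"
    and strict: "\<And>i j. i < n \<Longrightarrow> j \<le> i \<Longrightarrow> C $$ (i, j) = 0"
  shows "(\<Sum>i<n. (M * M) $$ (i, i)) = 0"
proof -
  note w = similar_mat_witD2[OF M sim]
  have trace_mult: "(\<Sum>i<n. (X * Y) $$ (i, i)) = (\<Sum>i<n. (Y * X) $$ (i, i))"
    if "X \<in> carrier_mat n n" "Y \<in> carrier_mat n n" for X Y :: "'a mat"
    using that sum.swap[of "\<lambda>i k. X $$ (i, k) * Y $$ (k, i)" "{..<n}" "{..<n}"]
    by (simp add: scalar_prod_def atLeast0LessThan mult.commute)
  have "M * M = (P * C * Q) * (P * C * Q)"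
    using w(3) by simp
  also have "\<dots> = P * (C * (Q * P) * C * Q)"
    using w(4-) by (simp add: assoc_mult_mat[of _ n n _ n _ n])
  finally have MM: "M * M = P * (C * C * Q)"
    using w by simp
  have "C * C * Q * P = C * C"
    using w(2,4-) by (simp add: assoc_mult_mat[of _ n n _ n _ n])
  then have "(\<Sum>i<n. (M * M) $$ (i, i)) = (\<Sum>i<n. (C * C) $$ (i, i))"
    unfolding MM using w by (subst trace_mult) auto
  also have "\<dots> = (\<Sum>i<n. \<Sum>k<n. C $$ (i, k) * C $$ (k, i))"
    using w by (simp add: scalar_prod_def atLeast0LessThan)
  also have "\<dots> = 0"
    by (intro sum.neutral ballI) (metis lessThan_iff linorder_linear mult_zero_left mult_zero_right strict)
  finally show ?thesis .
qed

lemma char_matrix_similar_wit: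
  assumes "similar_mat_wit A B P Q" and A: "A \<in> carrier_mat n n"
  shows "similar_mat_wit (char_matrix A a) (char_matrix B a) P Q"
proof -
  note w = similar_mat_witD2[OF A assms(1)]
  have "P * char_matrix B a * Q = P * B * Q + P * ((- a) \<cdot>\<^sub>m 1\<^sub>m n) * Q"
    using w by (simp add: char_matrix_def mult_add_distrib_mat[of _ n n _ n] add_mult_distrib_mat[of _ n n _ _ n])
  also have "P * ((- a) \<cdot>\<^sub>m 1\<^sub>m n) * Q = (- a) \<cdot>\<^sub>m 1\<^sub>m n"
    using w by (simp add: mult_smult_distrib[of _ n n _ n] mult_smult_assoc_mat[of _ n n _ n])
  finally show ?thesis
    using w by (intro similar_mat_witI[of _ _ n]) (auto simp: char_matrix_def)
qed

lemma char_matrix_product_index: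
  fixes A :: "'a :: field mat"
  assumes A: "A \<in> carrier_mat n n" and ij: "i < n" "j < n"
  shows "(char_matrix A a * char_matrix A b) $$ (i, j)
       = (\<Sum>k<n. A $$ (i, k) * A $$ (k, j)) - (a + b) * A $$ (i, j) + (if i = j then a * b else 0)"
proof -
  have "(char_matrix A a * char_matrix A b) $$ (i, j)
      = (\<Sum>k<n. (A $$ (i, k) - (if k = i then a else 0)) * (A $$ (k, j) - (if k = j then b else 0)))"
    using A ij by (auto simp: char_matrix_def scalar_prod_def atLeast0LessThan intro!: sum.cong)
  also have "\<dots> = (\<Sum>k<n. A $$ (i, k) * A $$ (k, j)) - (\<Sum>k<n. if k = i then a * A $$ (k, j) else 0)
      - (\<Sum>k<n. if k = j then A $$ (i, k) * b else 0)
      + (\<Sum>k<n. if k = i then if k = j then a * b else 0 else 0)"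
    unfolding sum_subtractf[symmetric] sum.distrib[symmetric]
    by (intro sum.cong) (auto simp: algebra_simps)
  finally show ?thesis
    using ij by (simp add: algebra_simps)
qed

text \<open>This is diagonalizability in the form needed here. A triangular matrix \<open>B\<close> similar to
  \<open>A\<close> has only \<open>a\<close> and \<open>b\<close> on its diagonal, so \<open>(B - a)(B - b)\<close> is strictly upper triangular and
  the symmetric matrix \<open>M = (A - a)(A - b)\<close> satisfies \<open>tr (M * M) = 0\<close>. For symmetric \<open>M\<close> this trace
  is the sum of the squared entries.\<close>

lemma real_symmetric_two_eigenvalues:
  fixes A :: "real mat"
  assumes A: "A \<in> carrier_mat n n" and sym: "transpose_mat A = A"
    and spec: "spectrum A \<subseteq> {a, b}"
  shows "char_matrix A a * char_matrix A b = 0\<^sub>m n n"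
proof -
  obtain es where es: "char_poly A = (\<Prod>e\<leftarrow>es. [:- e, 1:])"
    using real_symmetric_char_poly_splits[OF A sym] by auto
  obtain B P Q where B: "B \<in> carrier_mat n n" "upper_triangular B" and sim: "similar_mat_wit A B P Q"
    using schur_decomposition_exists[OF A es] unfolding similar_mat_def by auto
  define M where "M = char_matrix A a * char_matrix A b"
  define C where "C = char_matrix B a * char_matrix B b"
  have cA: "char_matrix A x \<in> carrier_mat n n" "char_matrix B x \<in> carrier_mat n n" for x
    using A B by auto
  have M: "M \<in> carrier_mat n n" using cA[of a] cA[of b] by (simp add: M_def)
  have diag: "B $$ (i, i) = a \<or> B $$ (i, i) = b" if "i < n" for i
  proof -
    have "char_poly A = (\<Prod>e\<leftarrow>diag_mat B. [:- e, 1:])"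
      using char_poly_similar[of A B] sim char_poly_upper_triangular[OF B]
      by (auto simp: similar_mat_def)
    moreover have "B $$ (i, i) \<in> set (diag_mat B)"
      using that B by (auto simp: diag_mat_def)
    ultimately have "poly (char_poly A) (B $$ (i, i)) = 0"
      by (auto simp: poly_prod_list prod_list_zero_iff)
    then show ?thesis
      using spec spectrum_root_char_poly[OF A] by auto
  qed
  have "similar_mat_wit M C P Q"
  proof -
    note w1 = similar_mat_witD2[OF cA(1) char_matrix_similar_wit[OF sim A, of a]]
    note w2 = similar_mat_witD2[OF cA(1) char_matrix_similar_wit[OF sim A, of b]]
    have "M = P * (char_matrix B a * (Q * P)) * char_matrix B b * Q"
      unfolding M_def w1(3) w2(3) using w1(4-) w2(4-) by (simp add: assoc_mult_mat[of _ n n _ n _ n])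
    then have "M = P * C * Q"
      unfolding C_def w1(2) using w1(4-) w2(4-) by (simp add: assoc_mult_mat[of _ n n _ n _ n])
    moreover have "C \<in> carrier_mat n n"
      unfolding C_def using cA(2) by (intro mult_carrier_mat)
    ultimately show ?thesis
      using w1(1,2,6,7) M by (intro similar_mat_witI[of _ _ n])
  qed
  moreover have "C $$ (i, j) = 0" if "i < n" "j \<le> i" for i j
  proof -
    have "char_matrix B a $$ (i, k) * char_matrix B b $$ (k, j) = 0" if k: "k < n" for k
    proof -
      consider "k < i" | "j < k" | "k = i" "j = i" using \<open>j \<le> i\<close> by linarith
      then show ?thesis
      proof cases
        case 3
        then show ?thesis using diag[of i] B k by (auto simp: char_matrix_def)
      qed (use B k that \<open>i < n\<close> upper_triangularD[OF B(2)] in \<open>auto simp: char_matrix_def\<close>)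
    qed
    then show ?thesis
      unfolding C_def using that cA[of a] cA[of b]
      by (auto simp: scalar_prod_def simp del: mult_eq_0_iff intro!: sum.neutral)
  qed
  ultimately have "(\<Sum>i<n. (M * M) $$ (i, i)) = 0"
    by (rule trace_square_similar_strictly_upper[OF _ M])
  moreover have symM: "M $$ (i, j) = M $$ (j, i)" if ij: "i < n" "j < n" for i j
  proof -
    have "A $$ (i, j) = A $$ (j, i)" if "i < n" "j < n" for i j
      using that A sym by (metis carrier_matD index_transpose_mat(1))
    then show ?thesis
      unfolding M_def using ij
      by (simp add: char_matrix_product_index[OF A] mult.commute)
  qed
  moreover have "(\<Sum>i<n. (M * M) $$ (i, i)) = (\<Sum>i<n. \<Sum>k<n. M $$ (i, k) * M $$ (k, i))"
    using M by (simp add: scalar_prod_def atLeast0LessThan)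
  moreover have "\<dots> = (\<Sum>i<n. \<Sum>k<n. (M $$ (i, k))\<^sup>2)"
    using symM by (intro sum.cong refl) (metis lessThan_iff power2_eq_square)
  ultimately have "(\<Sum>i<n. \<Sum>k<n. (M $$ (i, k))\<^sup>2) = 0"
    by simp
  then have "M $$ (i, k) = 0" if "i < n" "k < n" for i k
    using that by (simp add: sum_nonneg_eq_0_iff sum_nonneg)
  then show ?thesis
    using M unfolding M_def by (intro eq_matI) auto
qed

section \<open>Positive idempotent matrices\<close>

text \<open>A Perron--Frobenius argument: \<open>w = T \<bar>y\<bar> - \<bar>y\<bar>\<close> is nonnegative by the triangle inequality
  and killed by the idempotent \<open>T\<close>, so positivity of \<open>T\<close> forces \<open>w l = 0\<close>. As \<open>y l = 0\<close>, this says
  that the positive combination of all \<open>\<bar>y j\<bar>\<close> given by row \<open>l\<close> of \<open>T\<close> vanishes, hence \<open>y = 0\<close>.\<close>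

lemma positive_idempotent_fixed_vector_zero:
  fixes T :: "'i \<Rightarrow> 'i \<Rightarrow> real"
  assumes fin: "finite I"
    and pos: "\<And>i j. i \<in> I \<Longrightarrow> j \<in> I \<Longrightarrow> T i j > 0"
    and idem: "\<And>i j. i \<in> I \<Longrightarrow> j \<in> I \<Longrightarrow> (\<Sum>k\<in>I. T i k * T k j) = T i j"
    and fixed: "\<And>i. i \<in> I \<Longrightarrow> (\<Sum>j\<in>I. T i j * y j) = y i"
    and l: "l \<in> I" "y l = 0" and i: "i \<in> I"
  shows "y i = 0"
proof -
  define w where "w i = (\<Sum>j\<in>I. T i j * \<bar>y j\<bar>) - \<bar>y i\<bar>" for i
  have w_nonneg: "w i \<ge> 0" if "i \<in> I" for i
  proof -
    have "\<bar>y i\<bar> \<le> (\<Sum>j\<in>I. \<bar>T i j * y j\<bar>)"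
      unfolding fixed[OF that, symmetric] by (rule sum_abs)
    also have "\<dots> = (\<Sum>j\<in>I. T i j * \<bar>y j\<bar>)"
      using pos[OF that] by (intro sum.cong) (auto simp: abs_mult less_imp_le)
    finally show ?thesis by (simp add: w_def)
  qed
  have "(\<Sum>k\<in>I. T l k * w k) = (\<Sum>j\<in>I. (\<Sum>k\<in>I. T l k * T k j) * \<bar>y j\<bar>) - (\<Sum>k\<in>I. T l k * \<bar>y k\<bar>)"
    unfolding w_def right_diff_distrib sum_subtractf sum_distrib_left sum_distrib_right
    by (subst sum.swap) (simp add: mult.assoc)
  also have "\<dots> = 0"
    using idem[OF l(1)] by simp
  finally have "T l l * w l = 0"
    using sum_nonneg_eq_0_iff[OF fin, of "\<lambda>k. T l k * w k"] pos l w_nonneg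
    by (simp add: less_imp_le)
  then have "(\<Sum>j\<in>I. T l j * \<bar>y j\<bar>) = 0"
    using pos[OF l(1) l(1)] l(2) by (simp add: w_def)
  then have "T l i * \<bar>y i\<bar> = 0"
    using sum_nonneg_eq_0_iff[OF fin, of "\<lambda>j. T l j * \<bar>y j\<bar>"] pos l i
    by (simp add: less_imp_le)
  then show ?thesis
    using pos[OF l(1) i] by simp
qed

text \<open>A positive idempotent matrix has rank one. Its columns are fixed by \<open>T\<close>, hence so is the
  combination of columns \<open>j\<close> and \<open>l\<close> whose \<open>k\<close>-th coordinate cancels; that combination is zero.\<close>

lemma positive_idempotent_minors_vanish:
  fixes T :: "'i \<Rightarrow> 'i \<Rightarrow> real"
  assumes fin: "finite I"
    and pos: "\<And>i j. i \<in> I \<Longrightarrow> j \<in> I \<Longrightarrow> T i j > 0"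
    and idem: "\<And>i j. i \<in> I \<Longrightarrow> j \<in> I \<Longrightarrow> (\<Sum>k\<in>I. T i k * T k j) = T i j"
    and I: "i \<in> I" "j \<in> I" "k \<in> I" "l \<in> I"
  shows "T i j * T k l = T i l * T k j"
proof -
  define y where "y m = T m j * T k l - T m l * T k j" for m
  have "(\<Sum>m\<in>I. T n m * y m) = y n" if "n \<in> I" for n
  proof -
    have "(\<Sum>m\<in>I. T n m * y m)
        = (\<Sum>m\<in>I. T n m * T m j) * T k l - (\<Sum>m\<in>I. T n m * T m l) * T k j"
      by (simp add: y_def right_diff_distrib sum_subtractf sum_distrib_right mult.assoc)
    then show ?thesis
      using that I by (simp add: idem y_def)
  qed
  moreover have "y k = 0"
    by (simp add: y_def mult.commute)
  ultimately have "y i = 0"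
    using positive_idempotent_fixed_vector_zero[OF fin pos idem] I by blast
  then show ?thesis by (simp add: y_def)
qed

section \<open>Zero-diagonal positive matrices with two eigenvalues\<close>

text \<open>Let \<open>b < a\<close> be the eigenvalues. Since \<open>(S - a)(S - b) = 0\<close>, the matrix
  \<open>T = (S - b) / (a - b)\<close> is idempotent. The diagonal of \<open>S * S\<close> shows \<open>a b < 0\<close>, so \<open>b < 0\<close> and all
  entries of \<open>T\<close>, including the diagonal ones, are positive. Hence its two by two principal
  minors vanish, which says that every off-diagonal entry of \<open>S\<close> has square \<open>b\<^sup>2\<close>.\<close>

lemma two_eigenvalues_imp_constant:
  fixes S :: "real mat"
  assumes S: "S \<in> carrier_mat t t" and sym: "transpose_mat S = S" and t: "t \<ge> 2"
    and diag: "\<And>i. i < t \<Longrightarrow> S $$ (i, i) = 0"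
    and pos: "\<And>i j. i < t \<Longrightarrow> j < t \<Longrightarrow> i \<noteq> j \<Longrightarrow> S $$ (i, j) > 0"
    and card: "card (spectrum S) = 2"
  shows "\<exists>c>0. \<forall>i<t. \<forall>j<t. i \<noteq> j \<longrightarrow> S $$ (i, j) = c"
proof -
  \<comment> \<open>The quadratic equation is symmetric in the two eigenvalues, so the smaller one may be called \<open>b\<close>.\<close>
  obtain a b where spec: "spectrum S = {a, b}" and ba: "b < a"
    using card unfolding card_2_iff by (metis insert_commute linorder_neq_iff)
  have symS: "S $$ (i, j) = S $$ (j, i)" if "i < t" "j < t" for i j
    using that S sym by (metis carrier_matD index_transpose_mat(1))
  have quad: "(\<Sum>k<t. S $$ (i, k) * S $$ (k, j)) = (a + b) * S $$ (i, j) - (if i = j then a * b else 0)"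
    if ij: "i < t" "j < t" for i j
    using real_symmetric_two_eigenvalues[OF S sym, of a b] spec
      char_matrix_product_index[OF S ij, of a b] ij by simp
  have "a * b < 0"
  proof -
    have "0 < S $$ (0, 1) * S $$ (1, 0)"
      using pos t by simp
    also have "\<dots> \<le> (\<Sum>k<t. S $$ (0, k) * S $$ (k, 0))"
    proof (rule member_le_sum)
      show "0 \<le> S $$ (0, k) * S $$ (k, 0)" if "k \<in> {..<t} - {1}" for k
        using that t symS[of 0 k] by simp
    qed (use t in auto)
    also have "\<dots> = - (a * b)"
      using quad[of 0 0] diag[of 0] t by simp
    finally show ?thesis by simp
  qed
  then have b: "b < 0" and a: "a > 0"
    using ba by (auto simp: mult_less_0_iff)
  define T where "T i j = (S $$ (i, j) - (if i = j then b else 0)) / (a - b)" for i j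
  have T_pos: "T i j > 0" if "i \<in> {..<t}" "j \<in> {..<t}" for i j
    using that b ba pos diag by (auto simp: T_def)
  have T_idem: "(\<Sum>k<t. T i k * T k j) = T i j" if ij: "i \<in> {..<t}" "j \<in> {..<t}" for i j
  proof -
    have "(\<Sum>k<t. T i k * T k j) * (a - b)\<^sup>2 = (char_matrix S b * char_matrix S b) $$ (i, j)"
      using ba ij S unfolding sum_distrib_right
      by (auto simp: T_def power2_eq_square char_matrix_def scalar_prod_def atLeast0LessThan
          intro!: sum.cong)
    also have "\<dots> = T i j * (a - b)\<^sup>2"
    proof -
      have "T i j * (a - b)\<^sup>2 = (S $$ (i, j) - (if i = j then b else 0)) * (a - b)"
        using ba by (simp add: T_def power2_eq_square)
      then show ?thesis
        using ij quad[of i j] char_matrix_product_index[OF S, of i j b b]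
          by (simp add: algebra_simps split: if_splits)
    qed
    finally show ?thesis using ba by simp
  qed
  have "S $$ (i, j) = - b" if ij: "i < t" "j < t" "i \<noteq> j" for i j
  proof -
    have "T i j * T j i = T i i * T j j"
      using positive_idempotent_minors_vanish[OF _ T_pos T_idem, of i j j i] ij by simp
    then have "(S $$ (i, j))\<^sup>2 = (- b)\<^sup>2"
      using ij ba diag symS[of i j] by (simp add: T_def power2_eq_square)
    then show ?thesis
      using pos[OF ij] b by (simp only: power2_eq_iff) linarith
  qed
  then show ?thesis
    using b by (intro exI[of _ "- b"]) auto
qed

section \<open>The parts of a complete multipartite graph\<close>

locale complete_multipartite_parts = graph G
  for G :: "('a, 'b) pre_digraph" (structure) +
  fixes t :: nat and p :: "nat \<Rightarrow> nat" and W :: "nat \<Rightarrow> 'a set"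
  assumes part_size_pos: "i < t \<Longrightarrow> 1 \<le> p i"
    and parts_cover: "(\<Union>i<t. W i) = verts G"
    and parts_disjoint: "disjoint_family_on W {..<t}"
    and card_part: "i < t \<Longrightarrow> card (W i) = p i"
    and adjacent_iff: "\<lbrakk>i < t; j < t; u \<in> W i; v \<in> W j\<rbrakk> \<Longrightarrow> u \<rightarrow>\<^bsub>G\<^esub> v \<longleftrightarrow> i \<noteq> j"

lemma complete_multipartite_iff_parts:
  "complete_multipartite G t p \<longleftrightarrow> (\<exists>W. complete_multipartite_parts G t p W)"
proof -
  have "(\<forall>i<t. \<forall>j<t. \<forall>u\<in>W i. \<forall>v\<in>W j. u \<rightarrow>\<^bsub>G\<^esub> v \<longleftrightarrow> i \<noteq> j) \<longleftrightarrow>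
      (\<forall>i j u v. i < t \<longrightarrow> j < t \<longrightarrow> u \<in> W i \<longrightarrow> v \<in> W j \<longrightarrow> (u \<rightarrow>\<^bsub>G\<^esub> v) = (i \<noteq> j))" for W
    by auto
  then show ?thesis
    unfolding complete_multipartite_def complete_multipartite_parts_def
      complete_multipartite_parts_axioms_def by simp
qed

context complete_multipartite_parts
begin

lemma part_subset: "i < t \<Longrightarrow> W i \<subseteq> verts G"
  using parts_cover by blast

lemma finite_part: "i < t \<Longrightarrow> finite (W i)"
  using part_subset finite_verts finite_subset by blast

lemma vertex_in_part:
  assumes "v \<in> verts G"
  obtains i where "i < t" "v \<in> W i"
  using assms parts_cover by blast

lemma in_part_iff: "\<lbrakk>i < t; j < t; v \<in> W i\<rbrakk> \<Longrightarrow> v \<in> W j \<longleftrightarrow> j = i"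
  using parts_disjoint by (auto simp: disjoint_family_on_def)

lemma part_nonempty: "i < t \<Longrightarrow> W i \<noteq> {}"
  using part_size_pos[of i] card_part[of i] by auto

lemma card_verts: "card (verts G) = order_of_parts t p"
  unfolding parts_cover[symmetric] order_of_parts_def
  using card_UN_disjoint'[OF parts_disjoint] finite_part card_part by simp

text \<open>There are no parallel arcs, so the arcs leaving \<open>v\<close> correspond to their heads, which
  are exactly the vertices outside the part of \<open>v\<close>.\<close>

lemma out_degree_part:
  assumes i: "i < t" and v: "v \<in> W i"
  shows "real (out_degree G v) = part_degree t p i"
proof -
  have "bij_betw (head G) (out_arcs G v) (verts G - W i)"
  proof (rule bij_betwI')
    show "head G e = head G f \<longleftrightarrow> e = f" if "e \<in> out_arcs G v" "f \<in> out_arcs G v" for e f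
      using that no_multi_arcs[of e f] by (auto simp: arc_to_ends_def)
    show "head G e \<in> verts G - W i" if e: "e \<in> out_arcs G v" for e
    proof -
      have "v \<rightarrow>\<^bsub>G\<^esub> head G e"
        using e by (auto simp: arcs_ends_conv)
      then show ?thesis
        using adjacent_iff[OF i i v] e by auto
    qed
    show "\<exists>e\<in>out_arcs G v. u = head G e" if u: "u \<in> verts G - W i" for u
    proof -
      obtain j where "j < t" "u \<in> W j"
        using u vertex_in_part by blast
      then have "v \<rightarrow>\<^bsub>G\<^esub> u"
        using adjacent_iff[OF i _ v] u by blast
      then show ?thesis
        by (auto elim!: reachableE)
    qed
  qed
  then have "out_degree G v = card (verts G - W i)"
    unfolding out_degree_def by (rule bij_betw_same_card)
  then have "out_degree G v + p i = order_of_parts t p"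
    using card_Diff_subset[OF finite_part part_subset] card_mono[OF finite_verts part_subset]
      card_verts card_part i by simp
  then show ?thesis
    unfolding part_degree_def by linarith
qed

lemma regular_iff_equal_parts: "regular_graph G \<longleftrightarrow> (\<forall>i<t. \<forall>j<t. p i = p j)"
proof
  assume "regular_graph G"
  then obtain k where k: "out_degree G v = k" if "v \<in> verts G" for v
    unfolding regular_graph_def by auto
  have degree: "part_degree t p i = real k" if i: "i < t" for i
  proof -
    obtain v where v: "v \<in> W i" using part_nonempty[OF i] by blast
    then have "out_degree G v = k" using part_subset[OF i] by (intro k) blast
    then show ?thesis using out_degree_part[OF i v] by simp
  qed
  have "p i = p j" if "i < t" "j < t" for i j
    using degree[OF that(1)] degree[OF that(2)] unfolding part_degree_def by linarith
  then show "\<forall>i<t. \<forall>j<t. p i = p j"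
    by blast
next
  assume eq: "\<forall>i<t. \<forall>j<t. p i = p j"
  have "out_degree G v = nat \<lfloor>part_degree t p 0\<rfloor>" if v: "v \<in> verts G" for v
  proof -
    obtain i where i: "i < t" "v \<in> W i" by (rule vertex_in_part[OF v])
    have "part_degree t p 0 = part_degree t p i"
      using eq[rule_format, of 0 i] i unfolding part_degree_def by simp
    also have "\<dots> = real (out_degree G v)"
      using out_degree_part[OF i] by simp
    finally show ?thesis by simp
  qed
  then show "regular_graph G"
    unfolding regular_graph_def by blast
qed

lemma order_ge_number_of_parts: "t \<le> order_of_parts t p"
  using sum_mono[of "{..<t}" "\<lambda>_. 1" p] part_size_pos by (simp add: order_of_parts_def)

text \<open>The columns are the normalized indicator vectors of the parts; the normalization makes them
  orthonormal and produces the factors \<open>sqrt (p i * p j)\<close> of the part matrix.\<close>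

definition part_incidence :: "'a list \<Rightarrow> real mat" where
  "part_incidence vs =
     mat (length vs) t (\<lambda>(a, i). if vs ! a \<in> W i then 1 / sqrt (real (p i)) else 0)"

context
  fixes vs :: "'a list"
  assumes vs: "distinct vs" "set vs = verts G"
begin

lemma length_vertex_list: "length vs = order_of_parts t p"
  using vs card_verts distinct_card by metis

lemma part_incidence_orthonormal:
  "transpose_mat (part_incidence vs) * part_incidence vs = 1\<^sub>m t"
proof (rule eq_matI)
  fix i j assume "i < dim_row (1\<^sub>m t :: real mat)" "j < dim_col (1\<^sub>m t :: real mat)"
  then have i: "i < t" and j: "j < t" by auto
  have "(transpose_mat (part_incidence vs) * part_incidence vs) $$ (i, j)
      = (\<Sum>a<length vs. if vs ! a \<in> W i \<and> vs ! a \<in> W j then 1 / sqrt (real (p i)) * (1 / sqrt (real (p j))) else 0)"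
    using i j by (auto simp: part_incidence_def scalar_prod_def atLeast0LessThan intro!: sum.cong)
  also have "\<dots> = (\<Sum>v\<in>verts G. if v \<in> W i \<and> v \<in> W j then 1 / sqrt (real (p i)) * (1 / sqrt (real (p j))) else 0)"
    unfolding vs(2)[symmetric] sum.distinct_set_conv_list[OF vs(1)] sum_list_sum_nth
    by (simp add: atLeast0LessThan)
  also have "\<dots> = 1\<^sub>m t $$ (i, j)"
  proof (cases "i = j")
    case True
    have "(\<Sum>v\<in>verts G. if v \<in> W i then 1 / real (p i) else 0) = real (card (verts G \<inter> W i)) / real (p i)"
      by (simp add: sum.If_cases)
    also have "verts G \<inter> W i = W i" using part_subset i by blast
    finally have "(\<Sum>v\<in>verts G. if v \<in> W i then 1 / real (p i) else 0) = 1"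
      using part_size_pos[OF i] card_part[OF i] by simp
    moreover have "1 / sqrt (real (p i)) * (1 / sqrt (real (p i))) = 1 / real (p i)"
      by simp
    ultimately show ?thesis
      using i unfolding True[symmetric] by (simp only: conj_absorb index_one_mat simp_thms if_True)
  next
    case False
    then have "\<not> (v \<in> W i \<and> v \<in> W j)" for v
      using in_part_iff[OF i j] by blast
    then show ?thesis
      using False i j by (simp only: if_False sum.neutral_const) simp
  qed
  finally show "(transpose_mat (part_incidence vs) * part_incidence vs) $$ (i, j) = 1\<^sub>m t $$ (i, j)" .
qed (auto simp: part_incidence_def)

lemma weighted_adjacency_factorization:
  "weighted_adjacency \<phi> G vs
     = part_incidence vs * (part_matrix \<phi> t p * transpose_mat (part_incidence vs))"
proof (rule eq_matI)
  let ?N = "part_incidence vs"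
  fix a b
  assume "a < dim_row (?N * (part_matrix \<phi> t p * transpose_mat ?N))"
    "b < dim_col (?N * (part_matrix \<phi> t p * transpose_mat ?N))"
  then have a: "a < length vs" and b: "b < length vs"
    by (auto simp: part_incidence_def)
  obtain i where i: "i < t" "vs ! a \<in> W i"
    using vertex_in_part a vs(2) nth_mem by blast
  obtain j where j: "j < t" "vs ! b \<in> W j"
    using vertex_in_part b vs(2) nth_mem by blast
  have Na: "?N $$ (a, k) = (if k = i then 1 / sqrt (real (p i)) else 0)" if "k < t" for k
    using a that in_part_iff[OF i(1) that i(2)] by (simp add: part_incidence_def)
  have Nb: "?N $$ (b, l) = (if l = j then 1 / sqrt (real (p j)) else 0)" if "l < t" for l
    using b that in_part_iff[OF j(1) that j(2)] by (simp add: part_incidence_def)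
  have "(?N * (part_matrix \<phi> t p * transpose_mat ?N)) $$ (a, b)
      = (\<Sum>k<t. ?N $$ (a, k) * (\<Sum>l<t. part_matrix \<phi> t p $$ (k, l) * ?N $$ (b, l)))"
    using a b by (simp add: scalar_prod_def atLeast0LessThan part_incidence_def part_matrix_def)
  also have "\<dots> = (\<Sum>k<t. if k = i then 1 / sqrt (real (p i)) * (\<Sum>l<t. if l = j
      then part_matrix \<phi> t p $$ (k, l) * (1 / sqrt (real (p j))) else 0) else 0)"
    by (intro sum.cong refl) (simp add: Na Nb if_distrib cong: sum.cong_simp if_cong)
  also have "\<dots> = part_matrix \<phi> t p $$ (i, j) / (sqrt (real (p i)) * sqrt (real (p j)))"
    using i j by simp
  also have "\<dots> = weighted_adjacency \<phi> G vs $$ (a, b)"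
    using a b i j part_size_pos[OF i(1)] part_size_pos[OF j(1)] adjacent_iff[OF i(1) j(1) i(2) j(2)]
    by (simp add: weighted_adjacency_def part_matrix_def out_degree_part real_sqrt_mult)
  finally show "weighted_adjacency \<phi> G vs $$ (a, b) = (?N * (part_matrix \<phi> t p * transpose_mat ?N)) $$ (a, b)"
    by simp
qed (auto simp: weighted_adjacency_def part_incidence_def)

text \<open>With \<open>N\<close> the part incidence matrix and \<open>S\<close> the part matrix, the adjacency matrix is
  \<open>N * (S * N\<^sup>T)\<close>, while the opposite product \<open>(S * N\<^sup>T) * N\<close> is \<open>S\<close> by orthonormality. Products in
  opposite order have the same characteristic polynomial up to a power of \<open>x\<close>.\<close>

lemma char_poly_weighted_adjacency:
  "char_poly (weighted_adjacency \<phi> G vs)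
     = [:0, 1:] ^ (order_of_parts t p - t) * char_poly (part_matrix \<phi> t p)"
proof -
  let ?N = "part_incidence vs" and ?S = "part_matrix \<phi> t p" and ?n = "order_of_parts t p"
  have N: "?N \<in> carrier_mat ?n t" and S: "?S \<in> carrier_mat t t"
    by (auto simp: part_incidence_def part_matrix_def length_vertex_list)
  then have SN: "?S * transpose_mat ?N \<in> carrier_mat t ?n" by simp
  have "?S * transpose_mat ?N * ?N = ?S"
    using N S part_incidence_orthonormal by (simp add: assoc_mult_mat[of _ t t _ ?n _ t])
  then have "[:0, 1:] ^ t * char_poly (weighted_adjacency \<phi> G vs) = [:0, 1:] ^ ?n * char_poly ?S"
    using char_poly_mult_commute[OF N SN] by (simp add: weighted_adjacency_factorization)
  also have "[:0, 1:] ^ ?n = [:0, 1:] ^ t * ([:0, 1:] ^ (?n - t) :: real poly)"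
    using order_ge_number_of_parts by (simp flip: power_add)
  finally show ?thesis
    by (simp add: mult.assoc)
qed

lemma weighted_adjacency_carrier:
  "weighted_adjacency \<phi> G vs \<in> carrier_mat (order_of_parts t p) (order_of_parts t p)"
  by (simp add: weighted_adjacency_def length_vertex_list)

lemma spectrum_weighted_adjacency:
  assumes "order_of_parts t p > t"
  shows "spectrum (weighted_adjacency \<phi> G vs) = insert 0 (spectrum (part_matrix \<phi> t p))"
proof -
  have "part_matrix \<phi> t p \<in> carrier_mat t t" by (simp add: part_matrix_def)
  then show ?thesis
    using assms
    by (auto simp: spectrum_root_char_poly[OF weighted_adjacency_carrier] spectrum_root_char_poly
        char_poly_weighted_adjacency)
qed

end

end

section \<open>The constant condition and the spectrum\<close>

lemma char_poly_part_matrix_constant: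
  assumes "constant_between_parts \<phi> t p c" and "t \<ge> 1"
  shows "char_poly (part_matrix \<phi> t p) = [:c, 1:] ^ (t - 1) * [:- (real t - 1) * c, 1:]"
proof -
  have "part_matrix \<phi> t p = mat t t (\<lambda>(i, j). if i = j then 0 else c)"
    using assms(1) by (auto simp: part_matrix_def constant_between_parts_def intro!: eq_matI)
  then show ?thesis
    using char_poly_constant_off_diagonal[OF assms(2), of c] by simp
qed

lemma char_matrix_zero: "A \<in> carrier_mat n n \<Longrightarrow> char_matrix A 0 = A"
  by (intro eq_matI) (auto simp: char_matrix_def)

lemma det_part_matrix_constant:
  assumes const: "constant_between_parts \<phi> t p c" and "t \<ge> 2" "c \<noteq> 0"
  shows "det (part_matrix \<phi> t p) \<noteq> 0"
proof
  have S: "part_matrix \<phi> t p \<in> carrier_mat t t" by (simp add: part_matrix_def)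
  assume "det (part_matrix \<phi> t p) = 0"
  then have "eigenvalue (part_matrix \<phi> t p) 0"
    by (simp add: eigenvalue_det[OF S] char_matrix_zero[OF S])
  then show False
    using assms unfolding eigenvalue_root_char_poly[OF S]
    by (simp add: char_poly_part_matrix_constant[OF const])
qed

lemma Spec_weighted_adjacency_constant:
  assumes parts: "complete_multipartite_parts G t p W"
    and vs: "distinct vs" "set vs = verts G"
    and const: "constant_between_parts \<phi> t p c" and "t \<ge> 1"
  shows "Spec (weighted_adjacency \<phi> G vs) =
           replicate_mset (order_of_parts t p - t) 0
           + replicate_mset 1 ((real t - 1) * c)
           + replicate_mset (t - 1) (- c)"
proof -
  have repeat: "repeat_mset k {#x#} = replicate_mset k x" for k and x :: real
    by (induction k) auto
  define e where "e = (real t - 1) * c"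
  have "char_poly (weighted_adjacency \<phi> G vs)
      = [:0, 1:] ^ (order_of_parts t p - t) * ([:c, 1:] ^ (t - 1) * [:- e, 1:])"
    using char_poly_part_matrix_constant[OF const \<open>t \<ge> 1\<close>]
    by (simp only: complete_multipartite_parts.char_poly_weighted_adjacency[OF parts vs] e_def
        mult_minus_left)
  moreover have "[:x, 1:] ^ k \<noteq> 0" "[:x, 1:] \<noteq> 0" for x :: real and k
    by simp_all
  ultimately show ?thesis
    unfolding e_def[symmetric] Spec_def
    by (simp only: proots_mult proots_power proots_linear_factor repeat mult_eq_0_iff simp_thms
        minus_minus minus_zero ac_simps) simp
qed

lemma part_degree_pos:
  assumes "\<And>i. i < t \<Longrightarrow> 1 \<le> p i" and "i < t" "j < t" "i \<noteq> j"
  shows "part_degree t p i > 0"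
proof -
  have "p i + p j \<le> order_of_parts t p"
    using sum_mono2[of "{..<t}" "{i, j}" p] assms by (simp add: order_of_parts_def)
  then show ?thesis
    using assms(1)[OF \<open>j < t\<close>] unfolding part_degree_def by linarith
qed

lemma part_matrix_symmetric:
  assumes "\<And>i. i < t \<Longrightarrow> 1 \<le> p i" and "symmetric_weight \<phi>"
  shows "transpose_mat (part_matrix \<phi> t p) = part_matrix \<phi> t p"
  using part_degree_pos[OF assms(1)] assms(2)
  by (intro eq_matI) (auto simp: part_matrix_def symmetric_weight_def mult.commute)

text \<open>The adjacency matrix has the eigenvalues of \<open>S\<close> together with \<open>0\<close>, and \<open>0\<close> is not an
  eigenvalue of the nonsingular \<open>S\<close>. So three eigenvalues of the former mean two of the latter.\<close>

lemma card_spectrum_eq_3_iff_constant: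
  assumes parts: "complete_multipartite_parts G t p W"
    and vs: "distinct vs" "set vs = verts G"
    and weight: "symmetric_weight \<phi>" "positive_between_parts \<phi> t p"
    and t: "t \<ge> 2" and n: "order_of_parts t p > t" and det: "det (part_matrix \<phi> t p) \<noteq> 0"
  shows "card (spectrum (weighted_adjacency \<phi> G vs)) = 3
     \<longleftrightarrow> (\<exists>c>0. constant_between_parts \<phi> t p c)"
proof
  let ?S = "part_matrix \<phi> t p"
  have S: "?S \<in> carrier_mat t t" by (simp add: part_matrix_def)
  have pos: "1 \<le> p i" if "i < t" for i
    using complete_multipartite_parts.part_size_pos[OF parts that] .
  assume card: "card (spectrum (weighted_adjacency \<phi> G vs)) = 3"
  have "0 \<notin> spectrum ?S"
    using det by (simp add: spectrum_def eigenvalue_det[OF S] char_matrix_zero[OF S])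
  then have "card (spectrum ?S) = 2"
    using card card_finite_spectrum(1)[OF S]
    by (simp add: complete_multipartite_parts.spectrum_weighted_adjacency[OF parts vs n])
  moreover have "?S $$ (i, j) > 0" if "i < t" "j < t" "i \<noteq> j" for i j
    using that weight(2) pos[OF that(1)] pos[OF that(2)]
    by (simp add: part_matrix_def positive_between_parts_def)
  moreover have "?S $$ (i, i) = 0" if "i < t" for i
    using that by (simp add: part_matrix_def)
  ultimately obtain c where c: "c > 0" "\<forall>i<t. \<forall>j<t. i \<noteq> j \<longrightarrow> ?S $$ (i, j) = c"
    using two_eigenvalues_imp_constant[OF S part_matrix_symmetric[OF pos weight(1)] t] by blast
  have "constant_between_parts \<phi> t p c"
    unfolding constant_between_parts_def
  proof (intro allI impI)
    fix i j assume "i < t" "j < t" "i \<noteq> j"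
    then show "sqrt (real (p i) * real (p j)) * \<phi> (part_degree t p i) (part_degree t p j) = c"
      using c(2)[rule_format, of i j] by (simp add: part_matrix_def)
  qed
  then show "\<exists>c>0. constant_between_parts \<phi> t p c"
    using c(1) by blast
next
  assume "\<exists>c>0. constant_between_parts \<phi> t p c"
  then obtain c where c: "c > 0" "constant_between_parts \<phi> t p c" by blast
  let ?A = "weighted_adjacency \<phi> G vs"
  note carrier = complete_multipartite_parts.weighted_adjacency_carrier[OF parts vs, of \<phi>]
  have "char_poly ?A \<noteq> 0"
    using degree_monic_char_poly[OF carrier] by auto
  then have "spectrum ?A = set_mset (Spec ?A)"
    by (simp add: spectrum_root_char_poly[OF carrier] Spec_def)
  also have "\<dots> = {0, (real t - 1) * c, - c}"
    using Spec_weighted_adjacency_constant[OF parts vs c(2)] t n by auto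
  finally have "spectrum ?A = {0, (real t - 1) * c, - c}" .
  moreover have "(real t - 1) * c > 0"
    using c(1) t by simp
  moreover have "card {0, e, - c} = 3" if "e > 0" for e
    using that c(1) by (subst card_insert_disjoint, auto)+
  ultimately show "card (spectrum ?A) = 3"
    by simp
qed

text \<open>If all parts have size \<open>m\<close>, all degrees are equal to some \<open>d\<close> and \<open>c = m \<phi>(d, d)\<close> works.
  With fewer than two parts the condition is vacuous.\<close>

lemma equal_parts_imp_constant:
  assumes eq: "\<And>i j. i < t \<Longrightarrow> j < t \<Longrightarrow> p i = p j"
    and pos: "\<And>i. i < t \<Longrightarrow> 1 \<le> p i" and weight: "positive_between_parts \<phi> t p"
  shows "\<exists>c>0. constant_between_parts \<phi> t p c"
proof (cases "t \<ge> 2")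
  case True
  define d where "d = part_degree t p 0"
  have d: "part_degree t p i = d" if "i < t" for i
    using eq[OF that, of 0] that by (simp add: d_def part_degree_def)
  define m where "m = p 0"
  have p: "p i = m" if "i < t" for i
    using eq[OF that, of 0] that by (simp add: m_def)
  have "\<phi> d d > 0"
    using weight True d[of 0] d[of 1] unfolding positive_between_parts_def
    by (metis One_nat_def Suc_1 Suc_le_lessD less_le_trans pos2 zero_neq_one)
  then show ?thesis
    using d p pos[of 0] True
    by (intro exI[of _ "real m * \<phi> d d"]) (auto simp: constant_between_parts_def)
next
  case False
  then show ?thesis
    by (intro exI[of _ 1]) (auto simp: constant_between_parts_def)
qed

section \<open>A non-regular graph with the constant condition\<close>

text \<open>The graph is \<open>K\<^bsub>1,1,2\<^esub>\<close>, of order \<open>4\<close>. A vertex of degree \<open>x\<close> lies in a part of size \<open>4 - x\<close>,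
  so the weight \<open>1 / sqrt ((4 - x) (4 - y))\<close> cancels the factor \<open>sqrt (p i * p j)\<close> and gives \<open>c = 1\<close>.\<close>

lemma nonregular_constant_example:
  "\<exists>(\<psi> :: real \<Rightarrow> real \<Rightarrow> real) (H :: (nat, nat \<times> nat) pre_digraph) (s :: nat) (q :: nat \<Rightarrow> nat).
      complete_multipartite H s q \<and> s \<ge> 3 \<and> order_of_parts s q > s \<and>
      symmetric_weight \<psi> \<and> positive_between_parts \<psi> s q \<and>
      det (part_matrix \<psi> s q) \<noteq> 0 \<and>
      \<not> regular_graph H \<and>
      (\<exists>c>0. constant_between_parts \<psi> s q c)"
proof -
  define \<psi> :: "real \<Rightarrow> real \<Rightarrow> real" where "\<psi> x y = 1 / sqrt ((4 - x) * (4 - y))" for x y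
  \<comment> \<open>The parts of \<open>{0, 1, 2, 3}\<close> are \<open>{0}\<close>, \<open>{1}\<close> and \<open>{2, 3}\<close>.\<close>
  define part :: "nat \<Rightarrow> nat" where "part v = min v 2" for v
  define H :: "(nat, nat \<times> nat) pre_digraph" where
    "H = \<lparr>verts = {..<4}, arcs = {(u, v). u < 4 \<and> v < 4 \<and> part u \<noteq> part v}, tail = fst, head = snd\<rparr>"
  define q :: "nat \<Rightarrow> nat" where "q i = (if i = 2 then 2 else 1)" for i
  define W where "W i = {v. v < 4 \<and> part v = i}" for i
  have adj: "u \<rightarrow>\<^bsub>H\<^esub> v \<longleftrightarrow> u < 4 \<and> v < 4 \<and> part u \<noteq> part v" for u v
    by (auto simp: H_def arcs_ends_conv)
  have lt3: "i < 3 \<longleftrightarrow> i = 0 \<or> i = 1 \<or> i = 2" for i :: nat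
    by auto
  have "finite (arcs H)"
    by (rule finite_subset[of _ "{..<4} \<times> {..<4}"]) (auto simp: H_def)
  then have graph: "graph H"
    by unfold_locales (auto simp: H_def arc_to_ends_def symmetric_conv)
  have W: "W 0 = {0}" "W 1 = {1}" "W 2 = {2, 3}"
    by (auto simp: W_def part_def)
  have parts: "complete_multipartite_parts H 3 q W"
    using graph unfolding complete_multipartite_parts_def complete_multipartite_parts_axioms_def
  proof (intro conjI allI impI)
    show "(\<Union>i<3. W i) = verts H"
      by (auto simp: W_def H_def part_def)
    show "disjoint_family_on W {..<3}"
      by (auto simp: disjoint_family_on_def W_def)
    show "card (W i) = q i" if "i < 3" for i
      using that W by (auto simp: lt3 q_def)
    show "u \<rightarrow>\<^bsub>H\<^esub> v \<longleftrightarrow> i \<noteq> j" if "u \<in> W i" "v \<in> W j" for u v i j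
      using that by (auto simp: adj W_def)
  qed (auto simp: q_def)
  have order: "order_of_parts 3 q = 4"
    by (simp add: order_of_parts_def q_def numeral_3_eq_3)
  have "\<psi> (part_degree 3 q i) (part_degree 3 q j) = 1 / sqrt (real (q i) * real (q j))" for i j
    by (simp add: \<psi>_def part_degree_def order)
  moreover have q: "q i = 0 \<longleftrightarrow> False" "q i > 0" for i by (simp_all add: q_def)
  ultimately have pos: "positive_between_parts \<psi> 3 q" and const: "constant_between_parts \<psi> 3 q 1"
    by (simp_all add: positive_between_parts_def constant_between_parts_def q)
  have "\<not> regular_graph H"
    unfolding complete_multipartite_parts.regular_iff_equal_parts[OF parts]
  proof
    assume "\<forall>i<3. \<forall>j<3. q i = q j"
    from this[rule_format, of 0 2] show False by (simp add: q_def)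
  qed
  moreover have "symmetric_weight \<psi>"
    by (simp add: symmetric_weight_def \<psi>_def mult.commute)
  ultimately show ?thesis
    using parts pos const order det_part_matrix_constant[OF const]
    by (intro exI[of _ \<psi>] exI[of _ H] exI[of _ 3] exI[of _ q])
      (auto simp: complete_multipartite_iff_parts intro!: exI[of _ 1])
qed

theorem theorem2p7:
  fixes G :: "('a, 'b) pre_digraph"
    and vs :: "'a list"
    and t :: nat
    and p :: "nat \<Rightarrow> nat"
    and \<phi> :: "real \<Rightarrow> real \<Rightarrow> real"
  assumes "complete_multipartite G t p"
    and "distinct vs" and "set vs = verts G"
    and "symmetric_weight \<phi>"
    and "positive_between_parts \<phi> t p"
  shows
    "(t \<ge> 3 \<and> order_of_parts t p > t \<and> det (part_matrix \<phi> t p) \<noteq> 0 \<longrightarrow>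
        (card (spectrum (weighted_adjacency \<phi> G vs)) = 3 \<longleftrightarrow>
           (\<exists>c>0. constant_between_parts \<phi> t p c)) \<and>
        (\<forall>c>0. constant_between_parts \<phi> t p c \<longrightarrow>
           Spec (weighted_adjacency \<phi> G vs) =
             replicate_mset (order_of_parts t p - t) 0
             + replicate_mset 1 ((real t - 1) * c)
             + replicate_mset (t - 1) (- c)))
     \<and> (regular_graph G \<longleftrightarrow> (\<forall>i<t. \<forall>j<t. p i = p j))
     \<and> (regular_graph G \<longrightarrow> (\<exists>c>0. constant_between_parts \<phi> t p c))
     \<and> (\<exists>(\<psi> :: real \<Rightarrow> real \<Rightarrow> real) (H :: (nat, nat \<times> nat) pre_digraph) (s :: nat) (q :: nat \<Rightarrow> nat).
          complete_multipartite H s q \<and> s \<ge> 3 \<and> order_of_parts s q > s \<and>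
          symmetric_weight \<psi> \<and> positive_between_parts \<psi> s q \<and>
          det (part_matrix \<psi> s q) \<noteq> 0 \<and>
          \<not> regular_graph H \<and>
          (\<exists>c>0. constant_between_parts \<psi> s q c))"
proof -
  obtain W where parts: "complete_multipartite_parts G t p W"
    using assms(1) complete_multipartite_iff_parts by blast
  interpret complete_multipartite_parts G t p W by (rule parts)
  have regular: "regular_graph G \<longrightarrow> (\<exists>c>0. constant_between_parts \<phi> t p c)"
    using equal_parts_imp_constant[OF _ part_size_pos assms(5)] regular_iff_equal_parts by blast
  show ?thesis
  proof (intro conjI impI allI nonregular_constant_example regular_iff_equal_parts)
    assume t: "t \<ge> 3 \<and> order_of_parts t p > t \<and> det (part_matrix \<phi> t p) \<noteq> 0"
    then show "card (spectrum (weighted_adjacency \<phi> G vs)) = 3 \<longleftrightarrow>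
        (\<exists>c>0. constant_between_parts \<phi> t p c)"
      by (intro card_spectrum_eq_3_iff_constant[OF parts assms(2-5)]) auto
    show "Spec (weighted_adjacency \<phi> G vs) =
        replicate_mset (order_of_parts t p - t) 0 + replicate_mset 1 ((real t - 1) * c)
        + replicate_mset (t - 1) (- c)" if "constant_between_parts \<phi> t p c" for c
      using Spec_weighted_adjacency_constant[OF parts assms(2,3) that] t by simp
  qed (use regular in blast)
qed

end
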